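(* Let $w$ be an Arnoux-Rauzy word and let $t=A(w)$. Then for every $n\geq 4t+2$ the symmetry group of order $n$ of $w$ is $$G_n(w)=\{[1,2,\ldots,n-1,n],\ [n,n-1,\ldots,2,1]\}.$$
   Context: Infinite words are one-sided sequences of letters from a finite alphabet. $F_n(w)$ denotes the set of factors of length $n$ of $w$. A permutation $g\in S_n$ acts on a word $u=u_1\cdots u_n$ by $g(u)=u_{g^{-1}(1)}\cdots u_{g^{-1}(n)}$; the symmetry group of order $n$ of $w$ is $G_n(w)=\{\pi\in S_n \mid \pi(x)\in F_n(w)\text{ for each }x\in F_n(w)\}$. $[m_1,\ldots,m_n]$ denotes the permutation $i\mapsto m_i$. A factor $u$ of $w$ is left special (resp. right special) if there are at least two distinct letters $a,b$ such that $au,bu$ (resp. $ua,ub$) are factors of $w$. $u^R$ is the reversal of $u$. An infinite word $w$ on an alphabet $\Sigma$ is an Arnoux-Rauzy word if (i) whenever $u$ is a factor of $w$, so is $u^R$; and (ii) $w$ has exactly one left special factor (equivalently, right special factor) of each length, and each special factor extends in exactly $|\Sigma|$ ways. The palindromic right-closure $x^{(+)}$ of a finite word $x$ is the unique shortest palindrome having $x$ as a prefix. The iterated palindromic closure is defined by $Pal(\varepsilon)=\varepsilon$ and $Pal(xa)=(Pal(x)a)^{(+)}$ for a finite word $x$ and a letter $a$. It is a known theorem that $w$ is an Arnoux-Rauzy word if and only if there is an infinite word $v$ in which each letter of the alphabet occurs infinitely many times such that $w$ has the same set of factors as the limit of $Pal(p)$ over the prefixes $p$ of $v$. For such $w$ and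 $v$, $A(w)$ denotes the number $t$ of identical letters with which $v$ begins, i.e. the length of the longest prefix of $v$ consisting of a single repeated letter. *)

theory Defs
  imports "HOL-Combinatorics.Combinatorics" "HOL-Library.Sublist"
begin

text \<open>
  Infinite words are functions from \<open>nat\<close> and finite words are lists; positions are
  counted from 0.
\<close>

definition prefix_word :: "(nat \<Rightarrow> 'a) \<Rightarrow> nat \<Rightarrow> 'a list" where
  "prefix_word w n = map w [0..<n]"

definition factors :: "(nat \<Rightarrow> 'a) \<Rightarrow> 'a list set" where
  "factors w = {map w [i..<j] | i j. i \<le> j}"

definition factors_of_length :: "nat \<Rightarrow> (nat \<Rightarrow> 'a) \<Rightarrow> 'a list set" where
  "factors_of_length n w = {u \<in> factors w. length u = n}"


definition left_special :: "(nat \<Rightarrow> 'a) \<Rightarrow> 'a list \<Rightarrow> bool" where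
  "left_special w u \<longleftrightarrow>
     u \<in> factors w \<and> (\<exists>a b. a \<noteq> b \<and> a # u \<in> factors w \<and> b # u \<in> factors w)"

definition right_special :: "(nat \<Rightarrow> 'a) \<Rightarrow> 'a list \<Rightarrow> bool" where
  "right_special w u \<longleftrightarrow>
     u \<in> factors w \<and> (\<exists>a b. a \<noteq> b \<and> u @ [a] \<in> factors w \<and> u @ [b] \<in> factors w)"

text \<open>
  The condition \<open>card \<Sigma> \<ge> 2\<close> is implied: the left special factor of length 0 has
  two distinct extensions.
\<close>

definition arnoux_rauzy :: "'a set \<Rightarrow> (nat \<Rightarrow> 'a) \<Rightarrow> bool" where
  "arnoux_rauzy \<Sigma> w \<longleftrightarrow>
     finite \<Sigma> \<and> range w \<subseteq> \<Sigma> \<and>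
     (\<forall>u \<in> factors w. rev u \<in> factors w) \<and>
     (\<forall>n. \<exists>!u. length u = n \<and> left_special w u) \<and>
     (\<forall>u. left_special w u \<longrightarrow> card {a. a # u \<in> factors w} = card \<Sigma>) \<and>
     (\<forall>u. right_special w u \<longrightarrow> card {a. u @ [a] \<in> factors w} = card \<Sigma>)"


definition palindrome :: "'a list \<Rightarrow> bool" where
  "palindrome u \<longleftrightarrow> rev u = u"

definition pal_closure :: "'a list \<Rightarrow> 'a list" where
  "pal_closure x = (THE p. is_arg_min length (\<lambda>q. palindrome q \<and> prefix x q) p)"

definition Pal :: "'a list \<Rightarrow> 'a list" where
  "Pal x = foldl (\<lambda>p a. pal_closure (p @ [a])) [] x"

lemma Pal_Nil: "Pal [] = []"
  by (simp add: Pal_def)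

lemma Pal_snoc: "Pal (x @ [a]) = pal_closure (Pal x @ [a])"
  by (simp add: Pal_def)

text \<open>
  Each \<open>Pal (prefix_word v n)\<close> is a proper prefix of \<open>Pal (prefix_word v (Suc n))\<close>,
  so the limit is the unique infinite word having all of them as prefixes.
\<close>

definition Pal_limit :: "(nat \<Rightarrow> 'a) \<Rightarrow> (nat \<Rightarrow> 'a)" where
  "Pal_limit v =
     (THE c. \<forall>n. prefix_word c (length (Pal (prefix_word v n))) = Pal (prefix_word v n))"

definition directive_word :: "'a set \<Rightarrow> (nat \<Rightarrow> 'a) \<Rightarrow> (nat \<Rightarrow> 'a) \<Rightarrow> bool" where
  "directive_word \<Sigma> w v \<longleftrightarrow>
     range v \<subseteq> \<Sigma> \<and> (\<forall>a \<in> \<Sigma>. infinite {i. v i = a}) \<and>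
     factors w = factors (Pal_limit v)"

definition initial_run :: "(nat \<Rightarrow> 'a) \<Rightarrow> nat" where
  "initial_run v = (GREATEST t. \<exists>a. prefix_word v t = replicate t a)"

text \<open>
  An Arnoux-Rauzy word has a directive word, and all its directive words have the same
  initial run, so the description below is proper for such words.
\<close>

definition AR_index :: "'a set \<Rightarrow> (nat \<Rightarrow> 'a) \<Rightarrow> nat" where
  "AR_index \<Sigma> w = (THE t. \<exists>v. directive_word \<Sigma> w v \<and> initial_run v = t)"


text \<open>
  The symmetric group is taken on \<open>{..<n}\<close> instead of \<open>{1..n}\<close>, so that words are permuted
  by \<^const>\<open>permute_list\<close>; \<open>permute_list f u\<close> has the entry \<open>u ! f i\<close> at position \<open>i\<close>,
  hence the inverse below.  Elements of the symmetric group are the identity off \<open>{..<n}\<close>.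
\<close>

definition act_word :: "(nat \<Rightarrow> nat) \<Rightarrow> 'a list \<Rightarrow> 'a list" where
  "act_word g u = permute_list (inv g) u"

definition symmetry_group :: "nat \<Rightarrow> (nat \<Rightarrow> 'a) \<Rightarrow> (nat \<Rightarrow> nat) set" where
  "symmetry_group n w =
     {g. g permutes {..<n} \<and>
         (\<forall>x \<in> factors_of_length n w. act_word g x \<in> factors_of_length n w)}"

definition one_line :: "nat list \<Rightarrow> nat \<Rightarrow> nat" where
  "one_line ms i = (if i < length ms then ms ! i else i)"

end

theory Submission
  imports Defs "HOL-Library.Infinite_Set"
begin

text \<open>
  Let \<open>c\<close> be the infinite word whose prefixes are the left special factors of \<open>w\<close>. It is
  \<open>Pal_limit v\<close> for every directive word \<open>v\<close>, and so \<open>t\<close> is the length of its initial run of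
  the letter \<open>a = c 0\<close>. If two factors of length at least \<open>2 * t + 1\<close> differ in a single
  position and one of them has an \<open>a\<close> there, then this position is the first or the last: what
  precedes it is a reversed prefix of \<open>c\<close> and what follows it a prefix of \<open>c\<close>, so the run
  through an inner position would be longer than \<open>t + 1\<close>. Since the left special factor of
  length \<open>n - 1\<close> provides two such factors that differ in their first letter, a symmetry
  preserves the two end positions. Up to reversal it fixes them; the argument repeats on the
  remaining positions as long as at least \<open>2 * t + 1\<close> are left, from either end, and this
  reaches all positions when \<open>n \<ge> 4 * t\<close>.
\<close>

section \<open>Factors of infinite words\<close>

lemma map_upt_split: "i \<le> j \<Longrightarrow> j \<le> k \<Longrightarrow> map w [i..<k] = map w [i..<j] @ map w [j..<k]"
  using upt_add_eq_append[of i j "k - j"] by (simp flip: map_append)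

lemma factors_iff: "u \<in> factors w \<longleftrightarrow> (\<exists>i. map w [i..<i + length u] = u)"
proof
  assume "u \<in> factors w"
  then obtain i j where ij: "i \<le> j" "u = map w [i..<j]" unfolding factors_def by blast
  then have "i + length u = j" by simp
  with ij(2) show "\<exists>i. map w [i..<i + length u] = u" by metis
next
  assume "\<exists>i. map w [i..<i + length u] = u"
  then obtain i j where "map w [i..<j] = u" "i \<le> j" using le_add1 by blast
  then show "u \<in> factors w" unfolding factors_def by blast
qed

lemma map_upt_factor: "map w [i..<j] \<in> factors w"
proof (cases "i \<le> j")
  case True
  then show ?thesis unfolding factors_def by blast
next
  case False
  then have "map w [i..<j] = map w [0..<0]" by simp
  then show ?thesis unfolding factors_def by blast
qed

lemma
  assumes "u @ v \<in> factors w"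
  shows factors_appendD1: "u \<in> factors w" and factors_appendD2: "v \<in> factors w"
proof -
  from assms obtain i j where le: "i \<le> j" and ij: "u @ v = map w [i..<j]"
    unfolding factors_def by blast
  have j: "j = i + length u + length v"
    using arg_cong[OF ij, of length] le by simp
  have "u = take (length u) (map w [i..<j])" by (simp flip: ij)
  also have "\<dots> = map w [i..<i + length u]" by (simp add: take_map j)
  finally show "u \<in> factors w" by (metis map_upt_factor)
  have "v = drop (length u) (map w [i..<j])" by (simp flip: ij)
  also have "\<dots> = map w [i + length u..<j]" by (simp add: drop_map)
  finally show "v \<in> factors w" by (metis map_upt_factor)
qed

lemma factors_ConsD: "a # u \<in> factors w \<Longrightarrow> u \<in> factors w"
  using factors_appendD2[of "[a]" u] by simp

lemma map_upt_eq_replicate: "(\<And>i. i < n \<Longrightarrow> v i = a) \<Longrightarrow> map v [0..<n] = replicate n a"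
  by (intro nth_equalityI) auto

section \<open>Palindromic closure and its iteration\<close>

lemma palindrome_determined:
  assumes "palindrome p" "palindrome q" "prefix x p" "prefix x q" "length p = length q"
    and "length p \<le> 2 * length x"
  shows "p = q"
proof (rule nth_equalityI)
  have half: "p ! i = q ! i" if "i < length x" for i
    using that assms(3,4) by (metis nth_append prefix_def)
  fix i assume i: "i < length p"
  show "p ! i = q ! i"
  proof (cases "i < length x")
    case False
    \<comment> \<open>Since \<open>x\<close> covers at least half of \<open>p\<close>, the mirror
      image of a position behind \<open>x\<close> lies inside \<open>x\<close>.\<close>
    then have "length p - Suc i < length x" using assms(6) i by linarith
    from half[OF this] show ?thesis
      using i assms(1,2,5) unfolding palindrome_def by (metis rev_nth)
  qed (rule half)
qed (fact assms(5))

lemma palindrome_append_rev: "palindrome (x @ rev x)"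
  by (simp add: palindrome_def)

text \<open>The palindrome \<open>x @ rev x\<close> bounds the least length by
  \<open>2 * length x\<close>, and a palindrome that short is determined by its prefix
  \<open>x\<close>. So the definite description is proper.\<close>

lemma pal_closure_eqI:
  assumes "palindrome p" "prefix x p"
    and least: "\<And>q. palindrome q \<Longrightarrow> prefix x q \<Longrightarrow> length p \<le> length q"
  shows "pal_closure x = p"
  unfolding pal_closure_def
proof (rule the_equality)
  show "is_arg_min length (\<lambda>q. palindrome q \<and> prefix x q) p"
    using assms by (auto simp: is_arg_min_def not_less)
next
  fix q assume q: "is_arg_min length (\<lambda>q. palindrome q \<and> prefix x q) q"
  have "length q = length p"
    using q assms(1,2) least by (metis (no_types, lifting) is_arg_min_linorder le_antisym)
  moreover have "length p \<le> 2 * length x"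
    using least[OF palindrome_append_rev, of x] by simp
  ultimately show "q = p"
    using palindrome_determined[of q p x] q assms(1,2) by (simp add: is_arg_min_def)
qed

lemma pal_closure_props: "palindrome (pal_closure x)" "prefix x (pal_closure x)"
proof -
  obtain p where "is_arg_min length (\<lambda>q. palindrome q \<and> prefix x q) p"
    using ex_has_least_nat[of "\<lambda>q. palindrome q \<and> prefix x q" "x @ rev x" length]
      palindrome_append_rev[of x]
    by (auto simp: is_arg_min_linorder)
  then have p: "palindrome p" "prefix x p"
    and "\<And>q. palindrome q \<Longrightarrow> prefix x q \<Longrightarrow> length p \<le> length q"
    by (auto simp: is_arg_min_linorder)
  then have "pal_closure x = p" by (rule pal_closure_eqI)
  with p show "palindrome (pal_closure x)" "prefix x (pal_closure x)" by auto
qed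

lemma pal_closure_palindrome: "palindrome x \<Longrightarrow> pal_closure x = x"
  by (rule pal_closure_eqI) (auto simp: prefix_length_le)

lemma prefix_word_Suc: "prefix_word v (Suc n) = prefix_word v n @ [v n]"
  by (simp add: prefix_word_def)

lemma length_prefix_word [simp]: "length (prefix_word v n) = n"
  by (simp add: prefix_word_def)

lemma palindrome_Pal: "palindrome (Pal x)"
proof (cases x rule: rev_cases)
  case Nil
  then show ?thesis by (simp add: Pal_Nil palindrome_def)
next
  case (snoc y a)
  then show ?thesis by (simp add: Pal_snoc pal_closure_props)
qed

lemma prefix_Pal_snoc: "prefix (Pal x @ [a]) (Pal (x @ [a]))"
  by (simp add: Pal_snoc pal_closure_props)

lemma prefix_Pal_prefix_word:
  assumes "m \<le> n"
  shows "prefix (Pal (prefix_word v m)) (Pal (prefix_word v n))"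
  using assms
proof (induction n rule: dec_induct)
  case (step n)
  then show ?case
    unfolding prefix_word_Suc by (meson append_prefixD prefix_Pal_snoc prefix_order.trans)
qed simp

lemma length_Pal_prefix_word: "n \<le> length (Pal (prefix_word v n))"
proof (induction n)
  case (Suc n)
  have "length (Pal (prefix_word v n)) < length (Pal (prefix_word v (Suc n)))"
    unfolding prefix_word_Suc
    using prefix_length_le[OF prefix_Pal_snoc, of "prefix_word v n" "v n"] by simp
  with Suc show ?case by linarith
qed simp

lemma Pal_replicate: "Pal (replicate n a) = replicate n a"
proof (induction n)
  case (Suc n)
  have "palindrome (replicate n a @ [a])"
    by (simp add: palindrome_def replicate_append_same)
  with Suc show ?case
    by (metis Pal_snoc pal_closure_palindrome replicate_Suc replicate_append_same)
qed (simp add: Pal_Nil)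

section \<open>The limit of the iterated closures and the initial run\<close>

lemma Pal_limit_eqI:
  assumes "\<And>n. prefix_word c (length (Pal (prefix_word v n))) = Pal (prefix_word v n)"
  shows "Pal_limit v = c"
  unfolding Pal_limit_def
proof (rule the_equality)
  fix d assume d: "\<forall>n. prefix_word d (length (Pal (prefix_word v n))) = Pal (prefix_word v n)"
  show "d = c"
  proof
    fix i
    let ?m = "length (Pal (prefix_word v (Suc i)))"
    have "i < ?m" using length_Pal_prefix_word[of "Suc i" v] by simp
    moreover have "prefix_word d ?m = prefix_word c ?m" using d assms by simp
    ultimately show "d i = c i" by (simp add: prefix_word_def)
  qed
qed (use assms in auto)

text \<open>The palindromes form a chain of prefixes of unbounded length, so the description of
  \<open>Pal_limit\<close> is proper.\<close>

lemma prefix_word_Pal_limit: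
  "prefix_word (Pal_limit v) (length (Pal (prefix_word v n))) = Pal (prefix_word v n)"
proof -
  \<comment> \<open>\<open>Pal (prefix_word v (Suc i))\<close> has length at least
    \<open>Suc i\<close>, so position \<open>i\<close> lies inside it.\<close>
  define c where "c i = Pal (prefix_word v (Suc i)) ! i" for i
  have c: "prefix_word c (length (Pal (prefix_word v n))) = Pal (prefix_word v n)" for n
  proof (rule nth_equalityI)
    fix i assume "i < length (prefix_word c (length (Pal (prefix_word v n))))"
    then have i: "i < length (Pal (prefix_word v n))" by simp
    have i': "i < length (Pal (prefix_word v (Suc i)))"
      using length_Pal_prefix_word[of "Suc i" v] by simp
    have "Pal (prefix_word v (Suc i)) ! i = Pal (prefix_word v n) ! i"
      using prefix_Pal_prefix_word[of "Suc i" n v] prefix_Pal_prefix_word[of n "Suc i" v] i i'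
      by (metis nat_le_linear nth_append prefix_def)
    with i show "prefix_word c (length (Pal (prefix_word v n))) ! i = Pal (prefix_word v n) ! i"
      by (simp add: prefix_word_def c_def)
  qed simp
  then have "Pal_limit v = c" by (rule Pal_limit_eqI)
  with c show ?thesis by simp
qed

lemma initial_run_eqI:
  assumes "\<And>i. i < t \<Longrightarrow> v i = v 0" "v t \<noteq> v 0"
  shows "initial_run v = t"
  unfolding initial_run_def
proof (rule Greatest_equality)
  show "\<exists>a. prefix_word v t = replicate t a"
    using map_upt_eq_replicate[of t v "v 0"] assms(1) unfolding prefix_word_def by blast
next
  fix s assume "\<exists>a. prefix_word v s = replicate s a"
  then obtain a where a: "prefix_word v s = replicate s a" by blast
  have *: "v i = a" if "i < s" for i
    using that arg_cong[OF a, of "\<lambda>x. x ! i"] by (simp add: prefix_word_def)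
  show "s \<le> t"
  proof (rule ccontr)
    assume "\<not> s \<le> t"
    then have "v t = a" "v 0 = a" by (auto intro: *)
    with assms(2) show False by simp
  qed
qed

section \<open>Special factors of an Arnoux-Rauzy word\<close>

locale arnoux_rauzy_word =
  fixes \<Sigma> :: "'a set" and w :: "nat \<Rightarrow> 'a"
  assumes AR: "arnoux_rauzy \<Sigma> w"
begin

abbreviation F :: "'a list set" where "F \<equiv> factors w"

lemma finite_alphabet: "finite \<Sigma>"
  using AR by (simp add: arnoux_rauzy_def)

lemma rev_factor: "u \<in> F \<Longrightarrow> rev u \<in> F"
  using AR by (simp add: arnoux_rauzy_def)

lemma rev_factor_iff: "rev u \<in> F \<longleftrightarrow> u \<in> F"
  using rev_factor by fastforce

lemma set_factor: "u \<in> F \<Longrightarrow> set u \<subseteq> \<Sigma>"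
  using AR unfolding arnoux_rauzy_def factors_def by fastforce

lemma left_special_ex: "\<exists>u. length u = n \<and> left_special w u"
  using AR unfolding arnoux_rauzy_def by blast

lemma left_special_unique:
  "left_special w u \<Longrightarrow> left_special w v \<Longrightarrow> length u = length v \<Longrightarrow> u = v"
  using AR unfolding arnoux_rauzy_def by metis

lemma right_special_iff: "right_special w u \<longleftrightarrow> left_special w (rev u)"
proof -
  have "u @ [a] \<in> F \<longleftrightarrow> a # rev u \<in> F" for a
    using rev_factor_iff[of "u @ [a]"] by simp
  then show ?thesis by (simp add: right_special_def left_special_def rev_factor_iff)
qed

text \<open>The letters extending \<open>u\<close> form a subset of the finite alphabet with the
  same cardinality, hence all of it.\<close>

lemma left_special_Cons_iff:
  assumes "left_special w u"
  shows "a # u \<in> F \<longleftrightarrow> a \<in> \<Sigma>"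
proof -
  have "card {a. a # u \<in> F} = card \<Sigma>"
    using AR assms by (simp add: arnoux_rauzy_def)
  moreover have "{a. a # u \<in> F} \<subseteq> \<Sigma>"
    using set_factor by fastforce
  ultimately have "{a. a # u \<in> F} = \<Sigma>"
    using finite_alphabet by (simp add: card_subset_eq)
  then show ?thesis by blast
qed

lemma right_special_snoc_iff:
  "right_special w u \<Longrightarrow> u @ [a] \<in> F \<longleftrightarrow> a \<in> \<Sigma>"
  using left_special_Cons_iff[of "rev u" a] rev_factor_iff[of "u @ [a]"]
  by (simp add: right_special_iff)

lemma left_specialI: "a # u \<in> F \<Longrightarrow> b # u \<in> F \<Longrightarrow> a \<noteq> b \<Longrightarrow> left_special w u"
  using factors_ConsD unfolding left_special_def by fast

lemma right_specialI: "u @ [a] \<in> F \<Longrightarrow> u @ [b] \<in> F \<Longrightarrow> a \<noteq> b \<Longrightarrow> right_special w u"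
  using factors_appendD1 unfolding right_special_def by fast

lemma left_special_factor: "left_special w u \<Longrightarrow> u \<in> F"
  by (simp add: left_special_def)

lemma left_special_appendD: "left_special w (u @ v) \<Longrightarrow> left_special w u"
  unfolding left_special_def by (metis append_Cons factors_appendD1)

lemma two_letters: "\<exists>a b. a \<in> \<Sigma> \<and> b \<in> \<Sigma> \<and> a \<noteq> b"
proof -
  obtain u where "left_special w u" using left_special_ex by blast
  then show ?thesis
    using left_special_Cons_iff unfolding left_special_def by blast
qed

text \<open>The characteristic (or standard) word of \<open>w\<close>. The left special factors, one
  of each length, form a chain of prefixes; \<open>c i\<close> is the last letter of the one of
  length \<open>Suc i\<close>.\<close>

definition c :: "nat \<Rightarrow> 'a" where
  "c i = (THE u. length u = Suc i \<and> left_special w u) ! i"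

lemma left_special_prefix: "left_special w (map c [0..<n])"
proof -
  obtain u where u: "length u = n" "left_special w u" using left_special_ex by blast
  have "map c [0..<n] = u"
  proof (rule nth_equalityI)
    fix i assume "i < length (map c [0..<n])"
    then have i: "i < n" by simp
    have ls: "left_special w (take (Suc i) u)"
      using left_special_appendD[of "take (Suc i) u" "drop (Suc i) u"] u by simp
    have "(THE x. length x = Suc i \<and> left_special w x) = take (Suc i) u"
      by (rule the_equality) (use ls i u in \<open>auto intro: left_special_unique\<close>)
    with i show "map c [0..<n] ! i = u ! i" by (simp add: c_def)
  qed (use u in simp)
  with u show ?thesis by simp
qed

lemma left_special_eq: "left_special w u \<Longrightarrow> map c [0..<length u] = u"
  using left_special_unique left_special_prefix by fastforce

lemma right_special_eq: "right_special w u \<Longrightarrow> rev (map c [0..<length u]) = u"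
  using left_special_eq[of "rev u"] by (simp add: right_special_iff)

lemma right_special_rev_prefix: "right_special w (rev (map c [0..<n]))"
  by (simp only: right_special_iff rev_rev_ident left_special_prefix)

text \<open>Unboundedly many lengths suffice; this suits \<open>Pal_limit v\<close>, where
  specialness is shown for the palindromic prefixes \<open>Pal (prefix_word v n)\<close>.\<close>

lemma c_eqI:
  assumes "\<And>n. \<exists>m\<ge>n. left_special w (map d [0..<m])"
  shows "d = c"
proof
  fix i
  obtain m where m: "m \<ge> Suc i" "left_special w (map d [0..<m])" using assms by blast
  from left_special_eq[OF this(2)] have "map d [0..<m] = map c [0..<m]" by simp
  with m(1) show "d i = c i" by simp
qed

lemma c_in_alphabet: "c i \<in> \<Sigma>"
  using set_factor[OF left_special_factor[OF left_special_prefix[of "Suc i"]]] by auto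

text \<open>A late occurrence of \<open>u\<close> comes from reversing a long factor that continues an
  occurrence of \<open>rev u\<close>.\<close>

lemma recurrent:
  assumes "u \<in> F"
  shows "\<exists>i\<ge>N. map w [i..<i + length u] = u"
proof -
  from rev_factor[OF assms] obtain i where i: "map w [i..<i + length u] = rev u"
    by (auto simp: factors_iff)
  let ?x = "map w [i + length u..<i + length u + N]"
  have "rev u @ ?x = map w [i..<i + length u + N]"
    unfolding i[symmetric] by (rule map_upt_split[symmetric]) auto
  then have "rev (rev u @ ?x) \<in> F" by (metis map_upt_factor rev_factor)
  then have "rev ?x @ u \<in> F" by simp
  then obtain j where j: "map w [j..<j + length (rev ?x @ u)] = rev ?x @ u"
    unfolding factors_iff by blast
  have "u = drop N (rev ?x @ u)" by simp
  also have "\<dots> = drop N (map w [j..<j + N + length u])"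
    using j by (simp add: add.assoc)
  also have "\<dots> = map w [j + N..<j + N + length u]" by (simp add: drop_map)
  finally show ?thesis by (intro exI[of _ "j + N"]) auto
qed

text \<open>Otherwise \<open>u\<close> would determine everything that follows it, and two occurrences of \<open>u\<close>
  would make \<open>w\<close> eventually periodic, with the distance of the occurrences as a period.\<close>

lemma right_special_extension:
  assumes "u \<in> F"
  shows "\<exists>z. right_special w (u @ z)"
proof (rule ccontr)
  assume no: "\<nexists>z. right_special w (u @ z)"
  obtain i where i: "map w [i..<i + length u] = u" using assms by (auto simp: factors_iff)
  obtain i' where i': "i' \<ge> Suc i" "map w [i'..<i' + length u] = u"
    using recurrent[OF assms] by blast
  have eq: "map w [i..<i + length u + m] = map w [i'..<i' + length u + m]" for m
  proof (induction m)
    case 0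
    then show ?case using i i' by simp
  next
    case (Suc m)
    let ?U = "map w [i..<i + length u + m]"
    have "?U = u @ map w [i + length u..<i + length u + m]"
      using map_upt_split[of i "i + length u" "i + length u + m" w] i by simp
    then have ns: "\<not> right_special w ?U" using no by metis
    have 1: "map w [i..<i + length u + Suc m] = ?U @ [w (i + length u + m)]" by simp
    have 2: "map w [i'..<i' + length u + Suc m] = ?U @ [w (i' + length u + m)]"
      unfolding Suc by simp
    have "w (i + length u + m) = w (i' + length u + m)"
      using right_specialI[of ?U] ns 1 2 map_upt_factor by metis
    with 1 2 show ?case by simp
  qed
  have per: "w (i + j) = w (i' + j)" for j
    using arg_cong[OF eq[of "Suc j"], of "\<lambda>x. x ! j"] by (simp del: upt_Suc)
  define d where "d = i' - i"
  have d: "d > 0" using i'(1) by (simp add: d_def)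
  have shift: "w (k + d) = w k" if "k \<ge> i" for k
  proof -
    have "i' + (k - i) = k + d" using that i'(1) by (simp add: d_def)
    with per[of "k - i"] that show ?thesis by simp
  qed
  \<comment> \<open>Far to the right, the period \<open>d\<close> makes the letter after any word of
    length \<open>d\<close> repeat its first letter. The right special word \<open>?r\<close> would
    then have only one continuation.\<close>
  let ?r = "rev (map c [0..<d])"
  have len: "length ?r = d" by simp
  have hd: "a = ?r ! 0" if F: "?r @ [a] \<in> F" for a
  proof -
    obtain k where k: "k \<ge> i" "map w [k..<k + length (?r @ [a])] = ?r @ [a]"
      using recurrent[OF F] by blast
    have nth: "(?r @ [a]) ! m = w (k + m)" if "m \<le> d" for m
      using arg_cong[OF k(2), of "\<lambda>x. x ! m"] that by (simp del: upt_Suc)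
    have "a = (?r @ [a]) ! d" by (simp add: nth_append)
    also have "\<dots> = (?r @ [a]) ! 0" using nth[of d] nth[of 0] shift[OF k(1)] by simp
    also have "\<dots> = ?r ! 0" using d by (simp add: nth_append)
    finally show ?thesis .
  qed
  from right_special_rev_prefix[of d] hd show False unfolding right_special_def by metis
qed

lemma left_special_extension:
  assumes "u \<in> F"
  shows "\<exists>z. left_special w (z @ u)"
proof -
  obtain z where "right_special w (rev u @ z)"
    using right_special_extension rev_factor[OF assms] by blast
  then show ?thesis by (auto simp: right_special_iff)
qed

text \<open>Reading leftwards from \<open>u\<close>, a first disagreement of \<open>x\<close> and
  \<open>y\<close> would make the common part left special, which the last hypothesis excludes. Both
  results on palindromic prefixes below rest on this.\<close>

lemma left_extension_unique:
  assumes "length x = length y" "x @ u \<in> F" "y @ u \<in> F"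
    and "\<And>x1 x2. x = x1 @ x2 \<Longrightarrow> x1 \<noteq> [] \<Longrightarrow> \<not> left_special w (x2 @ u)"
  shows "x = y"
  using assms
proof (induction x y rule: list_induct2)
  case (Cons a x b y)
  have "x = y"
  proof (rule Cons.IH)
    show "x @ u \<in> F" "y @ u \<in> F" using Cons.prems factors_ConsD by fastforce+
    show "\<not> left_special w (x2 @ u)" if "x = x1 @ x2" "x1 \<noteq> []" for x1 x2
      using Cons.prems(3)[of "a # x1" x2] that by simp
  qed
  moreover have "a = b"
    using left_specialI[of a "x @ u" b] Cons.prems(1,2) Cons.prems(3)[of "[a]" x] \<open>x = y\<close>
    by auto
  ultimately show ?case by simp
qed simp

text \<open>Every factor extends to the left to a left special factor, and that is a prefix of
  \<open>c\<close>.\<close>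

lemma factors_c: "factors c = F"
proof
  show "factors c \<subseteq> F"
  proof
    fix u assume "u \<in> factors c"
    then obtain i where i: "map c [i..<i + length u] = u" by (auto simp: factors_iff)
    have "map c [0..<i] @ u = map c [0..<i + length u]"
      using i map_upt_split[of 0 i "i + length u" c] by simp
    then show "u \<in> F"
      using left_special_factor[OF left_special_prefix] factors_appendD2 by metis
  qed
  show "F \<subseteq> factors c"
  proof
    fix u assume "u \<in> F"
    then obtain z where "left_special w (z @ u)" using left_special_extension by blast
    then have "z @ u \<in> factors c" using left_special_eq map_upt_factor by metis
    then show "u \<in> factors c" by (rule factors_appendD2)
  qed
qed

text \<open>Extend the reversed prefix followed by \<open>e\<close> minimally to the left to a left special
  word \<open>s @ [e]\<close>. This extension is forced, so \<open>s\<close> is also right special.\<close>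

lemma palindromic_prefix_followed_by:
  assumes "e \<in> \<Sigma>"
  shows "\<exists>p\<ge>N. palindrome (map c [0..<p]) \<and> c p = e"
proof -
  let ?r = "rev (map c [0..<N])"
  let ?P = "\<lambda>z. left_special w (z @ ?r @ [e])"
  have "?r @ [e] \<in> F"
    using right_special_snoc_iff[OF right_special_rev_prefix] assms by blast
  then obtain z0 where "?P z0" using left_special_extension by blast
  then obtain z where z: "?P z" "\<And>y. ?P y \<Longrightarrow> length z \<le> length y"
    using ex_has_least_nat[of ?P z0 length] by blast
  define p where "p = length z + N"
  have "(z @ ?r) @ [e] = map c [0..<p] @ [c p]"
    using left_special_eq[OF z(1)] by (simp add: p_def)
  then have zp: "z @ ?r = map c [0..<p]" and ep: "e = c p" by (simp_all only: append1_eq_conv)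
  \<comment> \<open>A second left extension of \<open>?r @ [e]\<close>: the reversed prefix of
    length \<open>p\<close> is right special, so \<open>e\<close> may follow it. Minimality of
    \<open>z\<close> excludes left special words in between, so the two extensions agree.\<close>
  let ?y = "rev (map c [N..<p])"
  have yr: "rev (map c [0..<p]) = ?y @ ?r"
    using map_upt_split[of 0 N p c] by (simp add: p_def)
  have "z = ?y"
  proof (rule left_extension_unique)
    show "length z = length ?y" by (simp add: p_def)
    show "z @ ?r @ [e] \<in> F" using z(1) by (rule left_special_factor)
    show "?y @ ?r @ [e] \<in> F"
      using right_special_snoc_iff[OF right_special_rev_prefix[of p], of e] assms yr by simp
    show "\<not> ?P x2" if "z = x1 @ x2" "x1 \<noteq> []" for x1 x2
      using z(2)[of x2] that by auto
  qed
  then have "palindrome (map c [0..<p])"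
    using zp yr by (simp add: palindrome_def)
  then show ?thesis using ep by (intro exI[of _ p]) (simp add: p_def)
qed

text \<open>Let \<open>x = y @ s\<close> be the given prefix and \<open>s\<close> its longest palindromic suffix. No suffix of \<open>x\<close>
  between \<open>s\<close> and \<open>x\<close> is left special, since then
  \<open>s\<close> would not be the longest; hence \<open>s\<close> is followed
  by \<open>rev y\<close> within \<open>c\<close>.\<close>

lemma pal_closure_prefix:
  assumes pal: "palindrome (map c [0..<p])" "palindrome (map c [0..<p'])" and "p < p'"
    and between: "\<And>m. p < m \<Longrightarrow> m < p' \<Longrightarrow> \<not> palindrome (map c [0..<m])"
  shows "pal_closure (map c [0..<Suc p]) = map c [0..<p']"
proof -
  let ?B = "map c [0..<p]" and ?x = "map c [0..<Suc p]"
  let ?P = "\<lambda>s. palindrome s \<and> suffix s ?x"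
  have "?P [c p]" by (simp add: palindrome_def suffix_def)
  moreover have "\<forall>s. ?P s \<longrightarrow> length s < Suc (Suc p)"
    using suffix_length_le by fastforce
  ultimately obtain s where s: "?P s" "\<And>q. ?P q \<Longrightarrow> length q \<le> length s"
    using ex_has_greatest_nat[of ?P "[c p]" length "Suc (Suc p)"] by blast
  have s_ne: "length s \<ge> 1" using s(2)[OF \<open>?P [c p]\<close>] by simp
  obtain y where y: "?x = y @ s" using s(1) by (auto simp: suffix_def)
  have len: "length y + length s = Suc p" using arg_cong[OF y, of length] by simp
  have not_special: "\<not> left_special w (x2 @ s)" if x12: "y = x1 @ x2" "x1 \<noteq> []" for x1 x2
  proof
    assume "left_special w (x2 @ s)"
    \<comment> \<open>The left special word \<open>x2 @ s\<close> is the prefix of \<open>c\<close>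
      of length \<open>Suc m\<close>. The palindrome \<open>?B\<close> then begins and ends with the
      prefix of length \<open>m\<close>, which is therefore a palindrome, and in \<open>?x\<close>
      its last occurrence has \<open>c m\<close> on both sides. This is a palindromic suffix longer
      than \<open>s\<close>.\<close>
    define m where "m = length x2 + length s - 1"
    have m: "length (x2 @ s) = Suc m" "m < p"
    proof -
      show "length (x2 @ s) = Suc m" using s_ne by (simp add: m_def)
      have "length x1 > 0" using x12(2) by simp
      then show "m < p" using len s_ne unfolding x12(1) m_def length_append by linarith
    qed
    have z: "x2 @ s = map c [0..<m] @ [c m]"
      using left_special_eq[OF \<open>left_special w (x2 @ s)\<close>] m by simp
    have "?B @ [c p] = (x1 @ map c [0..<m]) @ [c m]"
      using y x12 z by simp
    then have B: "?B = x1 @ map c [0..<m]" and cp: "c p = c m"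
      by (simp_all only: append1_eq_conv)
    have lx1: "length x1 = p - m" using arg_cong[OF B, of length] by simp
    have B': "?B = map c [0..<m] @ c m # map c [Suc m..<p]"
      using map_upt_split[of 0 m p c] m(2) by (simp add: upt_conv_Cons)
    have "?B = rev ?B" using pal(1) by (simp add: palindrome_def)
    also have "\<dots> = (rev (map c [Suc m..<p]) @ [c m]) @ rev (map c [0..<m])"
      unfolding B' by simp
    finally have "x1 = rev (map c [Suc m..<p]) @ [c m] \<and> map c [0..<m] = rev (map c [0..<m])"
      unfolding B using lx1 m(2) by (subst (asm) append_eq_append_conv) auto
    then have x1: "x1 = rev (map c [Suc m..<p]) @ [c m]"
      and pm: "map c [0..<m] = rev (map c [0..<m])" by auto
    let ?q = "c m # map c [0..<m] @ [c m]"
    have "palindrome ?q" using pm by (simp add: palindrome_def)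
    moreover have "?x = rev (map c [Suc m..<p]) @ ?q"
      using y x12 x1 z by simp
    then have "suffix ?q ?x" by (auto simp: suffix_def)
    ultimately have "length ?q \<le> length s" using s(2) by blast
    then show False using m(1) by simp
  qed
  let ?u = "map c [Suc p..<Suc p + length y]"
  have ysu: "y @ s @ ?u = map c [0..<Suc p + length y]"
    using map_upt_split[of 0 "Suc p" "Suc p + length y" c] y by simp
  have "y = rev ?u"
  proof (rule left_extension_unique)
    show "y @ s \<in> F" using y left_special_factor[OF left_special_prefix] by metis
    have "s @ ?u \<in> F"
      using ysu left_special_factor[OF left_special_prefix] factors_appendD2 by metis
    then have "rev (s @ ?u) \<in> F" by (rule rev_factor)
    then show "rev ?u @ s \<in> F" using s(1) by (simp add: palindrome_def)
    show "length y = length (rev ?u)" by (simp del: upt_Suc)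
  qed (fact not_special)
  then have u: "rev y = ?u" by (rule rev_swap[THEN iffD2])
  have "palindrome (y @ s @ rev y)"
    using s(1) by (simp add: palindrome_def)
  then have "palindrome (map c [0..<Suc p + length y])" unfolding u ysu .
  then have p': "p' \<le> Suc p + length y"
    using between[of "Suc p + length y"] by linarith
  show ?thesis
  proof (rule pal_closure_eqI)
    show "prefix ?x (map c [0..<p'])"
      using map_upt_split[of 0 "Suc p" p' c] \<open>p < p'\<close> by (simp add: prefix_def)
    fix q assume q: "palindrome q" "prefix ?x q"
    show "length (map c [0..<p']) \<le> length q"
    proof (rule ccontr)
      assume "\<not> ?thesis"
      then have lq: "length q < p'" by simp
      obtain r where r: "q = ?x @ r" using q(2) by (auto simp: prefix_def)
      have lr: "length r < length y" using lq r p' by simp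
      \<comment> \<open>In a palindrome \<open>?x @ r\<close> the part of \<open>?x\<close> behind
        \<open>rev r\<close> is itself a palindrome; as \<open>r\<close> is shorter than
        \<open>y\<close>, this suffix would be longer than \<open>s\<close>.\<close>
      define s2 where "s2 = drop (length r) ?x"
      have e: "?x @ r = rev r @ rev ?x"
        using q(1) unfolding r palindrome_def by (metis rev_append)
      have "take (length r) (?x @ r) = rev r" unfolding e by simp
      then have t: "take (length r) ?x = rev r" using lr len by simp
      have x1: "?x = rev r @ s2" using t unfolding s2_def by (metis append_take_drop_id)
      have "(rev r @ s2) @ r = rev r @ rev (rev r @ s2)"
        using e unfolding x1 .
      then have "s2 = rev s2" by simp
      then have "?P s2" using x1 by (auto simp: palindrome_def suffix_def)
      then have "length s2 \<le> length s" by (rule s(2))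
      then show False using lr len by (simp add: s2_def)
    qed
  qed (fact pal(2))
qed

section \<open>Directive words and the index of \<open>w\<close>\<close>

lemma directive_word_ex: "\<exists>v. directive_word \<Sigma> w v"
proof -
  define S where "S = {p. palindrome (map c [0..<p])}"
  have inf: "infinite {p \<in> S. c p = e}" if "e \<in> \<Sigma>" for e
    unfolding infinite_nat_iff_unbounded_le S_def
    using palindromic_prefix_followed_by[OF that] by blast
  have infS: "infinite S"
    using inf[OF c_in_alphabet[of 0]] by (rule contrapos_nn) simp
  \<comment> \<open>\<open>v n\<close> is the letter that follows the \<open>n\<close>-th
    palindromic prefix of \<open>c\<close>, counted from the empty one at 0.\<close>
  define v where "v i = c (enumerate S i)" for i
  have Pal: "Pal (prefix_word v n) = map c [0..<enumerate S n]" for n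
  proof (induction n)
    case 0
    have "0 \<in> S" by (simp add: S_def palindrome_def)
    then have "enumerate S 0 = 0" by (simp add: enumerate_0 Least_eq_0)
    then show ?case by (simp add: prefix_word_def Pal_Nil)
  next
    case (Suc n)
    let ?p = "enumerate S n" and ?p' = "enumerate S (Suc n)"
    have "Pal (prefix_word v (Suc n)) = pal_closure (map c [0..<Suc ?p])"
      by (simp add: prefix_word_Suc Pal_snoc Suc v_def)
    also have "\<dots> = map c [0..<?p']"
    proof (rule pal_closure_prefix)
      show "palindrome (map c [0..<?p])" "palindrome (map c [0..<?p'])"
        using enumerate_in_set[OF infS] by (auto simp: S_def)
      show "?p < ?p'" by (rule enumerate_step[OF infS])
      show "\<not> palindrome (map c [0..<m])" if m: "?p < m" "m < ?p'" for m
        using m not_less_Least[of m "\<lambda>m. m \<in> S \<and> ?p < m"]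
        unfolding enumerate_Suc''[OF infS] by (auto simp: S_def)
    qed
    finally show ?case .
  qed
  have "Pal_limit v = c"
    by (rule Pal_limit_eqI) (simp add: Pal, simp add: prefix_word_def)
  moreover have "infinite {i. v i = e}" if "e \<in> \<Sigma>" for e
  proof
    assume "finite {i. v i = e}"
    then have "finite (enumerate S ` {i. v i = e})" by simp
    moreover have "{p \<in> S. c p = e} \<subseteq> enumerate S ` {i. v i = e}"
      using enumerate_Ex[OF infS] by (fastforce simp: v_def)
    ultimately show False using inf[OF that] finite_subset by blast
  qed
  ultimately show ?thesis
    using factors_c c_in_alphabet unfolding directive_word_def by (intro exI[of _ v]) (auto simp: v_def)
qed

text \<open>Every letter \<open>e\<close> occurs in \<open>v\<close> at some \<open>k >= n\<close>,
  and \<open>?P n\<close> is a suffix of the palindrome \<open>?P k\<close>, so \<open>e\<close> can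
  follow \<open>?P n\<close>. Thus \<open>?P n\<close> is right special and, being a palindrome,
  left special.\<close>

lemma Pal_limit_directive_word:
  assumes "directive_word \<Sigma> w v"
  shows "Pal_limit v = c"
proof (rule c_eqI)
  fix n
  let ?d = "Pal_limit v" and ?P = "\<lambda>k. Pal (prefix_word v k)"
  have d: "map ?d [0..<length (?P k)] = ?P k" for k
    using prefix_word_Pal_limit[of v k] by (simp add: prefix_word_def)
  have F: "x \<in> F" if "prefix x (?P k)" for x k
  proof -
    have "?P k \<in> factors ?d" using d[of k] map_upt_factor by metis
    then have "?P k \<in> F" using assms by (simp add: directive_word_def)
    with that show ?thesis using factors_appendD1 by (auto simp: prefix_def)
  qed
  have ext: "?P n @ [e] \<in> F" if "e \<in> \<Sigma>" for e
  proof -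
    have "infinite {i. v i = e}" using assms that by (simp add: directive_word_def)
    then obtain k where k: "k \<ge> n" "v k = e"
      unfolding infinite_nat_iff_unbounded_le by blast
    have "prefix (?P k @ [e]) (?P (Suc k))"
      unfolding prefix_word_Suc k(2) by (rule prefix_Pal_snoc)
    then have Fk: "?P k @ [e] \<in> F" by (rule F)
    obtain z where "?P k = ?P n @ z"
      using prefix_Pal_prefix_word[OF k(1), of v] by (auto simp: prefix_def)
    then have "?P k = rev z @ ?P n"
      using palindrome_Pal unfolding palindrome_def by (metis rev_append)
    with Fk show ?thesis using factors_appendD2[of "rev z"] by simp
  qed
  have "right_special w (?P n)"
    using two_letters ext right_specialI by blast
  then have "left_special w (map ?d [0..<length (?P n)])"
    using palindrome_Pal[of "prefix_word v n"] d by (simp add: right_special_iff palindrome_def)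
  then show "\<exists>m\<ge>n. left_special w (map ?d [0..<m])"
    using length_Pal_prefix_word by blast
qed

text \<open>A power of one letter is its own palindromic closure, so the limit starts with the
  initial run of \<open>v\<close> and the letter that ends it.\<close>

lemma initial_run_directive_word:
  assumes "directive_word \<Sigma> w v"
  shows "(\<forall>i < initial_run v. c i = c 0) \<and> c (initial_run v) \<noteq> c 0"
proof -
  have "\<exists>i. v i \<noteq> v 0"
  proof -
    obtain b where "b \<in> \<Sigma>" "b \<noteq> v 0" using two_letters by metis
    then have "{i. v i = b} \<noteq> {}" using assms unfolding directive_word_def by (metis finite.emptyI)
    with \<open>b \<noteq> v 0\<close> show ?thesis by blast
  qed
  define T where "T = (LEAST i. v i \<noteq> v 0)"
  have T: "v T \<noteq> v 0" "\<And>i. i < T \<Longrightarrow> v i = v 0"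
    using LeastI_ex[OF \<open>\<exists>i. v i \<noteq> v 0\<close>] not_less_Least unfolding T_def by blast+
  have run: "initial_run v = T" using T by (intro initial_run_eqI)
  have "prefix_word v T = replicate T (v 0)"
    unfolding prefix_word_def by (rule map_upt_eq_replicate) (fact T(2))
  then have "prefix (replicate T (v 0) @ [v T]) (Pal (prefix_word v (Suc T)))"
    using prefix_Pal_snoc[of "replicate T (v 0)" "v T"]
    by (simp add: prefix_word_Suc Pal_replicate)
  then obtain z where z: "Pal (prefix_word v (Suc T)) = (replicate T (v 0) @ [v T]) @ z"
    unfolding prefix_def by blast
  let ?m = "length (Pal (prefix_word v (Suc T)))"
  have pc: "map c [0..<?m] = Pal (prefix_word v (Suc T))"
    using prefix_word_Pal_limit[of v "Suc T"] Pal_limit_directive_word[OF assms]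
    by (simp add: prefix_word_def)
  have m: "T < ?m" using z by simp
  have *: "c i = ((replicate T (v 0) @ [v T]) @ z) ! i" if "i \<le> T" for i
    using arg_cong[OF pc, of "\<lambda>x. x ! i"] that m unfolding z by (simp del: upt_Suc)
  have "c i = v 0" if "i < T" for i using *[of i] that by (simp add: nth_append)
  moreover have "c T = v T" using *[of T] by (simp add: nth_append)
  moreover have "T \<noteq> 0" using T(1) by metis
  ultimately show ?thesis using T(1) run by simp
qed

text \<open>The two conditions on the run determine its length, so all directive words give the same
  value.\<close>

lemma AR_index_run:
  "(\<forall>i < AR_index \<Sigma> w. c i = c 0) \<and> c (AR_index \<Sigma> w) \<noteq> c 0"
proof -
  obtain v where v: "directive_word \<Sigma> w v" using directive_word_ex by blast
  have index: "AR_index \<Sigma> w = initial_run v"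
    unfolding AR_index_def
  proof (rule the_equality)
    fix t assume "\<exists>v. directive_word \<Sigma> w v \<and> initial_run v = t"
    then have "(\<forall>i < t. c i = c 0) \<and> c t \<noteq> c 0" using initial_run_directive_word by blast
    then show "t = initial_run v"
      using initial_run_directive_word[OF v] by (metis linorder_neqE_nat)
  qed (use v in blast)
  show ?thesis unfolding index by (rule initial_run_directive_word[OF v])
qed


text \<open>Otherwise the run of length \<open>t + 1\<close>, which is not left special, would always be preceded
  by \<open>c 0\<close> and so have no left special extension.\<close>

lemma run_not_factor:
  assumes run: "\<forall>i<t. c i = c 0" "c t \<noteq> c 0"
  shows "replicate (Suc (Suc t)) (c 0) \<notin> F"
proof
  let ?a = "c 0" and ?R = "replicate (Suc t) (c 0)"
  assume "replicate (Suc (Suc t)) (c 0) \<in> F"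
  then have aR: "?a # ?R \<in> F" by simp
  \<comment> \<open>Left special words are prefixes of \<open>c\<close>, and \<open>c t\<close> ends
    the run.\<close>
  have const: "False" if "left_special w (replicate n ?a)" "n > t" for n
  proof -
    have "replicate n ?a ! t = map c [0..<n] ! t"
      using left_special_eq[OF that(1)] by simp
    with that(2) run(2) show False by simp
  qed
  obtain z where z: "left_special w (z @ ?R)"
    using left_special_extension factors_ConsD[OF aR] by blast
  show False
  proof (cases "\<exists>b\<in>set z. b \<noteq> ?a")
    case True
    then obtain z1 b z2 where z12: "z = z1 @ b # z2" "b \<noteq> ?a" "\<forall>x\<in>set z2. x = ?a"
      using split_list_last_prop[of z "\<lambda>x. x \<noteq> ?a"] by blast
    \<comment> \<open>\<open>b\<close> is the last letter of \<open>z\<close> other than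
      \<open>c 0\<close>, so at least \<open>t + 1\<close> letters \<open>c 0\<close> follow
      it.\<close>
    have "z2 = replicate (length z2) ?a"
      using z12(3) by (simp add: replicate_length_same)
    then have comm: "z2 @ ?R = ?R @ z2"
      by (metis add.commute replicate_add)
    have "b # z2 @ ?R \<in> F"
      using left_special_factor[OF z] factors_appendD2[of z1] z12(1) by simp
    then have "b # ?R \<in> F"
      unfolding comm using factors_appendD1[of "b # ?R" z2] by simp
    from left_specialI[OF this aR z12(2)] show False by (rule const) simp
  next
    case False
    then have "z = replicate (length z) ?a" by (simp add: replicate_length_same)
    then have "z @ ?R = replicate (length z + Suc t) ?a"
      by (metis replicate_add)
    with z show False using const[of "length z + Suc t"] by simp
  qed
qed

section \<open>Factors that differ in a single position\<close>

lemma differ_only_at_end: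
  assumes run: "\<forall>i<t. c i = c 0" "c t \<noteq> c 0"
    and F: "u @ c 0 # v \<in> F" "u @ d # v \<in> F" and d: "d \<noteq> c 0"
    and len: "2 * t \<le> length u + length v"
  shows "u = [] \<or> v = []"
proof (rule ccontr)
  assume ne: "\<not> (u = [] \<or> v = [])"
  let ?a = "c 0"
  have "u @ [?a] \<in> F" "u @ [d] \<in> F"
    using F factors_appendD1[of "u @ [e]" v for e] by simp_all
  then have u: "rev (map c [0..<length u]) = u"
    using d right_specialI right_special_eq by metis
  have "?a # v \<in> F" "d # v \<in> F" using F factors_appendD2 by blast+
  then have v: "map c [0..<length v] = v"
    using d left_specialI left_special_eq by metis
  have rep: "map c [0..<t] = replicate t ?a"
    by (rule map_upt_eq_replicate) (use run(1) in blast)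
  have big: "\<exists>z. map c [0..<m] = replicate t ?a @ z" if "m \<ge> t" for m
    using map_upt_split[OF le0 that, of c] rep by auto
  have small: "\<exists>z. map c [0..<m] = ?a # z" if "m > 0" for m
    using that by (simp add: upt_conv_Cons)
  \<comment> \<open>One side has length at least \<open>t\<close> and contributes \<open>t\<close>
    letters \<open>c 0\<close> next to the middle one; the other side is nonempty and contributes
    one more. Together they make \<open>t + 2\<close>.\<close>
  have "\<exists>x z. u @ ?a # v = x @ replicate (Suc (Suc t)) ?a @ z"
  proof (cases "length u \<ge> t")
    case True
    obtain x where "map c [0..<length u] = replicate t ?a @ x" using big True by blast
    then have "u = rev x @ replicate t ?a" by (subst u[symmetric]) simp
    moreover obtain z where "v = ?a # z" using small[of "length v"] ne v by auto
    ultimately have "u @ ?a # v = rev x @ (replicate t ?a @ [?a, ?a]) @ z" by simp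
    then show ?thesis by (metis replicate_append_same replicate_Suc append_Cons append_Nil append_assoc)
  next
    case False
    with len have "length v \<ge> t" by simp
    then obtain z where "v = replicate t ?a @ z" using big v by metis
    moreover obtain x where "map c [0..<length u] = ?a # x" using small[of "length u"] ne by auto
    then have "u = rev x @ [?a]" by (subst u[symmetric]) simp
    ultimately have "u @ ?a # v = rev x @ replicate (Suc (Suc t)) ?a @ z" by simp
    then show ?thesis by blast
  qed
  then show False
    using F(1) run_not_factor[OF run] factors_appendD1 factors_appendD2 by metis
qed

text \<open>Recurrence gives an occurrence with room for \<open>k\<close> letters before it. These
  letters will fill the positions already known to be fixed.\<close>

lemma left_extension_length:
  assumes "u \<in> F"
  shows "\<exists>z. length z = k \<and> z @ u \<in> F"
proof -
  obtain i where i: "i \<ge> k" "map w [i..<i + length u] = u" using recurrent[OF assms] by blast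
  have "map w [i - k..<i] @ u = map w [i - k..<i + length u]"
    using map_upt_split[of "i - k" i "i + length u" w] i(2) by simp
  then show ?thesis
    using i(1) map_upt_factor by (intro exI[of _ "map w [i - k..<i]"]) auto
qed

end

section \<open>Permutations acting on words\<close>

lemma act_word_nth:
  "g permutes {..<length u} \<Longrightarrow> i < length u \<Longrightarrow> act_word g u ! i = u ! inv g i"
  unfolding act_word_def by (simp add: permute_list_nth permutes_inv)

lemma length_act_word [simp]: "length (act_word g u) = length u"
  by (simp add: act_word_def)

text \<open>The inverse in \<open>act_word\<close> makes it a left action.\<close>

lemma act_word_comp:
  assumes "f permutes {..<length u}" "g permutes {..<length u}"
  shows "act_word (f \<circ> g) u = act_word f (act_word g u)"
proof -
  have "inv (f \<circ> g) = inv g \<circ> inv f"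
    using assms by (simp add: o_inv_distrib permutes_bij)
  then show ?thesis
    using assms by (simp add: act_word_def permute_list_compose permutes_inv)
qed

lemma symmetry_group_comp:
  "f \<in> symmetry_group n w \<Longrightarrow> g \<in> symmetry_group n w \<Longrightarrow> f \<circ> g \<in> symmetry_group n w"
  by (auto simp: symmetry_group_def factors_of_length_def act_word_comp permutes_compose)

lemma id_in_symmetry_group: "id \<in> symmetry_group n w"
  by (simp add: symmetry_group_def act_word_def permutes_id)

lemma one_line_upt: "one_line [0..<n] = id"
  by (auto simp: one_line_def)

lemma one_line_rev_upt: "one_line (rev [0..<n]) i = (if i < n then n - 1 - i else i)"
  by (simp add: one_line_def rev_nth)

lemma one_line_rev_upt_involution: "one_line (rev [0..<n]) \<circ> one_line (rev [0..<n]) = id"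
  by (auto simp: one_line_rev_upt)

lemma one_line_rev_upt_permutes: "one_line (rev [0..<n]) permutes {..<n}"
proof (rule bij_imp_permutes)
  show "bij_betw (one_line (rev [0..<n])) {..<n} {..<n}"
    by (rule bij_betw_byWitness[where f' = "one_line (rev [0..<n])"]) (auto simp: one_line_rev_upt)
qed (simp add: one_line_rev_upt)

lemma act_word_one_line_rev: "act_word (one_line (rev [0..<length u])) u = rev u"
proof (rule nth_equalityI)
  fix i assume i: "i < length (act_word (one_line (rev [0..<length u])) u)"
  have "inv (one_line (rev [0..<length u])) = one_line (rev [0..<length u])"
    using one_line_rev_upt_involution by (metis inv_unique_comp)
  with i show "act_word (one_line (rev [0..<length u])) u ! i = rev u ! i"
    by (simp add: act_word_nth one_line_rev_upt_permutes one_line_rev_upt rev_nth)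
qed simp

section \<open>Symmetries of an Arnoux-Rauzy word\<close>

context arnoux_rauzy_word
begin

lemma one_line_rev_in_symmetry_group: "one_line (rev [0..<n]) \<in> symmetry_group n w"
  using one_line_rev_upt_permutes rev_factor
  by (auto simp: symmetry_group_def factors_of_length_def act_word_one_line_rev)

text \<open>The left special factor of length \<open>n - p - 1\<close> can be preceded by
  \<open>c 0\<close> and by \<open>c t\<close>. Both words are padded to length \<open>n\<close> on
  the left; the paddings may differ, but they stay in the fixed positions and are dropped after
  permuting.\<close>

lemma symmetry_image_of_fixed_prefix:
  assumes run: "\<forall>i<t. c i = c 0" "c t \<noteq> c 0"
    and g: "g \<in> symmetry_group n w" and fix_p: "\<And>i. i < p \<Longrightarrow> g i = i"
    and n: "p + 2 * t + 1 \<le> n"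
  shows "g p = p \<or> g p = n - 1"
proof -
  have perm: "g permutes {..<n}"
    and gF: "\<And>x. x \<in> F \<Longrightarrow> length x = n \<Longrightarrow> act_word g x \<in> F"
    using g by (auto simp: symmetry_group_def factors_of_length_def)
  let ?u = "map c [0..<n - p - 1]" and ?a = "c 0" and ?d = "c t"
  have ext: "e # ?u \<in> F" if "e \<in> \<Sigma>" for e
    using left_special_Cons_iff[OF left_special_prefix] that by blast
  obtain z where z: "length z = p" "z @ ?a # ?u \<in> F"
    using left_extension_length[OF ext[OF c_in_alphabet]] by blast
  obtain z' where z': "length z' = p" "z' @ ?d # ?u \<in> F"
    using left_extension_length[OF ext[OF c_in_alphabet]] by blast
  let ?x = "z @ ?a # ?u" and ?y = "z' @ ?d # ?u"
  have len: "length ?x = n" "length ?y = n" using z z' n by auto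
  define X Y where XY_def: "X = drop p (act_word g ?x)" "Y = drop p (act_word g ?y)"
  have XF: "X \<in> F" "Y \<in> F"
    unfolding XY_def using gF z(2) z'(2) len factors_appendD2 by (metis append_take_drop_id)+
  have lX: "length X = n - p" "length Y = n - p" unfolding XY_def using len by simp_all
  have inv_fix: "inv g i = i" if "i < p" for i
    using fix_p[OF that] perm by (metis permutes_inverses(2))
  \<comment> \<open>The letter at position \<open>p\<close> moves to \<open>g p\<close>, so after
    the drop the two words differ exactly at \<open>k\<close>.\<close>
  define k where "k = g p - p"
  have gp: "p \<le> g p" "g p < n"
  proof -
    show "p \<le> g p"
      using fix_p permutes_inj[OF perm] by (metis injD linorder_not_le nat_less_le)
    show "g p < n" using permutes_in_image[OF perm, of p] n by simp
  qed
  have k: "p + k = g p" "k < n - p" using gp by (auto simp: k_def)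
  have Xn: "X ! j = ?x ! inv g (p + j)" "Y ! j = ?y ! inv g (p + j)" if "j < n - p" for j
    unfolding XY_def using that perm len by (simp_all add: act_word_nth)
  have inv_gp: "inv g (p + k) = p" unfolding k(1) using perm by (simp add: permutes_inverses(2))
  have Xk: "X ! k = ?a" "Y ! k = ?d"
    using Xn[OF k(2)] inv_gp z(1) z'(1) by (simp_all add: nth_append)
  have XY: "X ! j = Y ! j" if j: "j < n - p" "j \<noteq> k" for j
  proof -
    have "inv g (p + j) \<ge> p"
      using inv_fix perm by (metis linorder_not_le not_add_less1 permutes_inverses(1))
    moreover have "inv g (p + j) \<noteq> p"
      using k(1) j(2) perm by (metis add_left_cancel permutes_inverses(1))
    ultimately have "inv g (p + j) > p" by simp
    then show ?thesis using Xn[OF j(1)] z(1) z'(1) by (simp add: nth_append nth_Cons')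
  qed
  have "X = take k X @ ?a # drop (Suc k) X"
    using id_take_nth_drop[of k X] lX k(2) Xk(1) by metis
  moreover have "take k X = take k Y"
    using lX k(2) XY by (intro nth_equalityI) auto
  moreover have "drop (Suc k) X = drop (Suc k) Y"
  proof (rule nth_equalityI)
    fix i assume "i < length (drop (Suc k) X)"
    then have "Suc k + i < n - p" using lX by simp
    then show "drop (Suc k) X ! i = drop (Suc k) Y ! i"
      using XY[of "Suc k + i"] lX by simp
  qed (simp only: length_drop lX)
  moreover have "Y = take k Y @ ?d # drop (Suc k) Y"
    using id_take_nth_drop[of k Y] lX k(2) Xk(2) by metis
  ultimately have "take k X @ ?a # drop (Suc k) X \<in> F" "take k X @ ?d # drop (Suc k) X \<in> F"
    using XF by metis+
  then have "take k X = [] \<or> drop (Suc k) X = []"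
  proof (rule differ_only_at_end[OF run])
    show "2 * t \<le> length (take k X) + length (drop (Suc k) X)"
      unfolding length_take length_drop[of "Suc k"] lX using k(2) n by simp
  qed (use run(2) in \<open>simp_all\<close>)
  then have "k = 0 \<or> n - p \<le> Suc k"
    using lX k(2) by (metis drop_eq_Nil2 take_eq_Nil less_nat_zero_code list.size(3))
  then show ?thesis using k n by linarith
qed

text \<open>From the left the positions below \<open>n - 2 * t\<close> are fixed, from the right
  those from \<open>2 * t\<close> on; by \<open>4 * t <= n\<close> these ranges cover all
  positions.\<close>

lemma symmetry_fixing_last_eq_id:
  assumes run: "\<forall>i<t. c i = c 0" "c t \<noteq> c 0"
    and g: "g \<in> symmetry_group n w" and last: "g (n - 1) = n - 1"
    and n: "4 * t \<le> n" "2 * t + 1 \<le> n"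
  shows "g = id"
proof -
  have left: "h p = p"
    if "h \<in> symmetry_group n w" "h (n - 1) = n - 1" "p + 2 * t + 1 \<le> n" for h p
    using that(3)
  proof (induction p rule: less_induct)
    case (less p)
    have "h permutes {..<n}" using that(1) by (simp add: symmetry_group_def)
    \<comment> \<open>Injectivity excludes the far end for every other \<open>p\<close>, since it is
      already the image of \<open>n - 1\<close>.\<close>
    then have "h p = n - 1 \<Longrightarrow> p = n - 1"
      using that(2) permutes_inj by (metis injD)
    moreover have "h p = p \<or> h p = n - 1"
      using run that(1) by (rule symmetry_image_of_fixed_prefix) (use less in auto)
    ultimately show ?case by auto
  qed
  let ?r = "one_line (rev [0..<n])"
  \<comment> \<open>Conjugation by the reversal exchanges the two ends, so the argument from the
    left also works from the right.\<close>
  let ?h = "?r \<circ> g \<circ> ?r"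
  have perm: "g permutes {..<n}" using g by (simp add: symmetry_group_def)
  have g0: "g 0 = 0" using left[OF g last, of 0] n by simp
  have h: "?h \<in> symmetry_group n w"
    using g one_line_rev_in_symmetry_group symmetry_group_comp by blast
  have hl: "?h (n - 1) = n - 1" using g0 n by (simp add: one_line_rev_upt)
  have right: "g i = i" if "2 * t \<le> i" "i < n" for i
  proof -
    have "?h (n - 1 - i) = n - 1 - i" using left[OF h hl] that by simp
    moreover have "g i < n" using permutes_in_image[OF perm, of i] that by simp
    ultimately show ?thesis using that by (simp add: one_line_rev_upt)
  qed
  show "g = id"
  proof
    fix i
    consider "i + 2 * t + 1 \<le> n" | "2 * t \<le> i" "i < n" | "i \<ge> n" using n by linarith
    then show "g i = id i"
    proof cases
      case 1
      then show ?thesis using left[OF g last] by simp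
    next
      case 2
      then show ?thesis using right by simp
    next
      case 3
      then show ?thesis using permutes_not_in[OF perm, of i] by simp
    qed
  qed
qed

text \<open>A symmetry fixes the last position or sends it to 0; composition with the reversal turns
  the second case into the first.\<close>

lemma symmetry_group_eq:
  assumes run: "\<forall>i<t. c i = c 0" "c t \<noteq> c 0"
    and n: "4 * t \<le> n" "2 * t + 1 \<le> n"
  shows "symmetry_group n w = {one_line [0..<n], one_line (rev [0..<n])}"
proof -
  let ?r = "one_line (rev [0..<n])"
  have r: "?r \<in> symmetry_group n w" by (rule one_line_rev_in_symmetry_group)
  have "g = id \<or> g = ?r" if g: "g \<in> symmetry_group n w" for g
  proof -
    have perm: "g permutes {..<n}" using g by (simp add: symmetry_group_def)
    \<comment> \<open>The conjugate sends 0 to \<open>n - 1 - g (n - 1)\<close>, so its value at 0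
      tells where \<open>g\<close> sends the last position.\<close>
    have rgr: "?r \<circ> g \<circ> ?r \<in> symmetry_group n w" and rg: "?r \<circ> g \<in> symmetry_group n w"
      using g r symmetry_group_comp by blast+
    have "(?r \<circ> g \<circ> ?r) 0 = 0 \<or> (?r \<circ> g \<circ> ?r) 0 = n - 1"
      using run rgr by (rule symmetry_image_of_fixed_prefix) (use n in auto)
    moreover have "g (n - 1) < n" using permutes_in_image[OF perm, of "n - 1"] n by simp
    ultimately have "g (n - 1) = n - 1 \<or> g (n - 1) = 0"
      using n by (auto simp: one_line_rev_upt)
    then show ?thesis
    proof
      assume "g (n - 1) = n - 1"
      with run g have "g = id" using n by (rule symmetry_fixing_last_eq_id)
      then show ?thesis ..
    next
      assume "g (n - 1) = 0"
      then have "(?r \<circ> g) (n - 1) = n - 1" using n by (simp add: one_line_rev_upt)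
      with run rg have "?r \<circ> g = id" using n by (rule symmetry_fixing_last_eq_id)
      then have "g = ?r" using one_line_rev_upt_involution
        by (metis comp_assoc comp_id id_comp)
      then show ?thesis ..
    qed
  qed
  then show ?thesis using r id_in_symmetry_group[of n w] unfolding one_line_upt by blast
qed

end

theorem theorem2:
  fixes \<Sigma> :: "'a set" and w :: "nat \<Rightarrow> 'a" and t n :: nat
  assumes "arnoux_rauzy \<Sigma> w"
    and "t = AR_index \<Sigma> w"
    and "n \<ge> 4 * t + 2"
  shows "symmetry_group n w = {one_line [0..<n], one_line (rev [0..<n])}"
proof -
  interpret arnoux_rauzy_word \<Sigma> w by standard (fact assms(1))
  show ?thesis
    using AR_index_run unfolding assms(2)[symmetric]
    by (elim conjE, intro symmetry_group_eq[of t]) (assumption | use assms(3) in linarith)+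
qed

end
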